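(* Let $X$ be a real Banach space. A locally uniformly nonsquare point $x\in S_X$ is not a $\Delta$-point of $X$.
   Context: $B_X$ and $S_X$ denote the closed unit ball and unit sphere. A point $x\in S_X$ is a locally uniformly nonsquare point if there exists $\delta>0$ such that $\min\{\|x+y\|,\|x-y\|\}\le 2-\delta$ for all $y\in S_X$. For $x\in S_X$ and $\epsilon>0$ let $\Delta_\epsilon(x)=\{y\in B_X:\|x-y\|\ge 2-\epsilon\}$. A point $x\in S_X$ is a $\Delta$-point if $x\in\overline{\mathrm{conv}}\,\Delta_\epsilon(x)$ for every $\epsilon>0$. *)

theory Defs
  imports "HOL-Analysis.Analysis"
begin

definition locally_uniformly_nonsquare_point :: "'a::real_normed_vector \<Rightarrow> bool" where
  "locally_uniformly_nonsquare_point x \<longleftrightarrow>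
     x \<in> sphere 0 1 \<and>
     (\<exists>\<delta>>0. \<forall>y\<in>sphere 0 1. min (norm (x + y)) (norm (x - y)) \<le> 2 - \<delta>)"

definition Delta_set :: "real \<Rightarrow> 'a::real_normed_vector \<Rightarrow> 'a set" where
  "Delta_set \<epsilon> x = {y \<in> cball 0 1. norm (x - y) \<ge> 2 - \<epsilon>}"

definition Delta_point :: "'a::real_normed_vector \<Rightarrow> bool" where
  "Delta_point x \<longleftrightarrow>
     x \<in> sphere 0 1 \<and> (\<forall>\<epsilon>>0. x \<in> closure (convex hull (Delta_set \<epsilon> x)))"

end

(* On Delta_\<epsilon>(x) the vectors x - y are almost as long as possible, so nonsquareness at x
   forces norm (x + y) \<le> 2 - \<delta> + \<epsilon> there. Hence Delta_\<epsilon>(x) lies in a closed ball around -x of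
   radius less than 2; this ball is closed and convex but misses x. *)

theory Submission
  imports Defs
begin

text \<open>Nonsquareness tests only unit vectors, while \<open>Delta_set\<close> lives in the ball;
  this is the cost of replacing \<open>y\<close> by \<open>sgn y\<close>.\<close>

lemma norm_diff_sgn_ball:
  fixes y :: "'a::real_normed_vector"
  assumes "y \<noteq> 0" "norm y \<le> 1"
  shows "norm (sgn y - y) = 1 - norm y"
proof -
  have "sgn y - y = (1 - norm y) *\<^sub>R sgn y"
    using assms(1) by (simp add: sgn_div_norm algebra_simps)
  then show ?thesis
    using assms by (simp add: norm_sgn)
qed

lemma Delta_set_subset_cball_uminus:
  fixes x :: "'a::real_normed_vector"
  assumes x: "norm x = 1"
    and \<delta>: "\<And>y. norm y = 1 \<Longrightarrow> min (norm (x + y)) (norm (x - y)) \<le> 2 - \<delta>"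
    and \<epsilon>: "\<epsilon> < 1" "2 * \<epsilon> < \<delta>"
  shows "Delta_set \<epsilon> x \<subseteq> cball (- x) (2 - \<delta> + \<epsilon>)"
proof
  fix y assume "y \<in> Delta_set \<epsilon> x"
  then have y: "norm y \<le> 1" "2 - \<epsilon> \<le> norm (x - y)"
    by (auto simp: Delta_set_def)
  have y_ge: "1 - \<epsilon> \<le> norm y"
    using y(2) norm_triangle_ineq4[of x y] x by linarith
  \<comment> \<open>At 0 the value of \<open>sgn\<close> is 0, not a unit vector, so \<epsilon> < 1
    is what makes normalisation possible.\<close>
  then have "y \<noteq> 0"
    using \<epsilon>(1) by auto
  then have near: "norm (sgn y - y) \<le> \<epsilon>" and unit: "norm (sgn y) = 1"
    using norm_diff_sgn_ball[of y] y(1) y_ge by (auto simp: norm_sgn)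
  have "norm (x - y) \<le> norm (x - sgn y) + norm (sgn y - y)"
    using norm_triangle_ineq[of "x - sgn y" "sgn y - y"] by simp
  \<comment> \<open>One \<epsilon> is lost in \<open>Delta_set\<close>, another in normalising, so
    2\<epsilon> < \<delta> forces the bound in \<delta> onto \<open>x + sgn y\<close>.\<close>
  then have "norm (x - sgn y) > 2 - \<delta>"
    using y(2) near \<epsilon>(2) by linarith
  then have "norm (x + sgn y) \<le> 2 - \<delta>"
    using \<delta>[OF unit] by auto
  \<comment> \<open>Returning from \<open>sgn y\<close> to \<open>y\<close> adds the \<epsilon> in
    the radius.\<close>
  moreover have "norm (x + y) \<le> norm (x + sgn y) + norm (sgn y - y)"
    using norm_triangle_ineq4[of "x + sgn y" "sgn y - y"] by simp
  moreover have "dist (- x) y = norm (x + y)"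
    by (metis dist_norm minus_add_distrib norm_minus_cancel uminus_add_conv_diff add.commute)
  ultimately show "y \<in> cball (- x) (2 - \<delta> + \<epsilon>)"
    using near by simp
qed

theorem theorem4p2:
  fixes x :: "'a::banach"
  assumes "x \<in> sphere 0 1"
    and "locally_uniformly_nonsquare_point x"
  shows "\<not> Delta_point x"
proof
  assume "Delta_point x"
  have x: "norm x = 1"
    using assms(1) by simp
  obtain \<delta> where "\<delta> > 0"
    and \<delta>: "\<And>y. norm y = 1 \<Longrightarrow> min (norm (x + y)) (norm (x - y)) \<le> 2 - \<delta>"
    using assms(2) by (auto simp: locally_uniformly_nonsquare_point_def)
  \<comment> \<open>The bound \<delta>/4 gives 2\<epsilon> < \<delta>, hence also a radius 2 -
    \<delta> + \<epsilon> below 2, the distance from \<open>- x\<close> to \<open>x\<close>; the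
    bound 1/2 gives \<epsilon> < 1.\<close>
  define \<epsilon> where "\<epsilon> = min (\<delta> / 4) (1 / 2)"
  have \<epsilon>: "\<epsilon> > 0" "\<epsilon> < 1" "2 * \<epsilon> < \<delta>"
    using \<open>\<delta> > 0\<close> by (auto simp: \<epsilon>_def)
  have "closure (convex hull Delta_set \<epsilon> x) \<subseteq> cball (- x) (2 - \<delta> + \<epsilon>)"
    using Delta_set_subset_cball_uminus[OF x \<delta> \<epsilon>(2,3)]
    by (intro closure_minimal hull_minimal) auto
  then have "x \<in> cball (- x) (2 - \<delta> + \<epsilon>)"
    using \<open>Delta_point x\<close> \<epsilon>(1) by (auto simp: Delta_point_def)
  moreover have "dist (- x) x = 2"
    using x by (simp add: dist_norm flip: scaleR_2)
      (metis norm_minus_cancel norm_scaleR abs_numeral mult.right_neutral scaleR_2 minus_add_distrib uminus_add_conv_diff add.commute)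
  ultimately show False
    using \<epsilon> by simp
qed

end
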